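(* Let $(a_i)_{i\ge 1}$ be a sequence of nonzero complex numbers such that the function $i\mapsto |a_i|$ is strictly increasing and $$\lim_{i\to\infty}\frac{|a_{i+1}|}{|a_i|}=\infty .$$ Consider the element $$f:= y+a_1x^{-1}t+a_2x^{-2}t^2+a_3x^{-3}t^3+\cdots$$ of $\mathbb{C}[x^{\pm},y][[t]]$, and let $(f)$ be the ideal of $\mathbb{C}[x^{\pm},y][[t]]$ generated by $f$. Then $$(f)\cap \mathbb{C}[x,y][[t]]=(0).$$
   Context: $\mathbb{C}[x^{\pm},y]=\mathbb{C}[x,x^{-1},y]$ is the ring of polynomials in $y$ with coefficients Laurent polynomials in $x$, and $R[[t]]$ denotes the ring of formal power series in $t$ over $R$; $\mathbb{C}[x,y][[t]]$ is regarded as a subring of $\mathbb{C}[x^{\pm},y][[t]]$ in the obvious way. *)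

theory Defs
  imports
    Complex_Main
    "HOL-Library.Poly_Mapping"
    "HOL-Computational_Algebra.Polynomial"
    "HOL-Computational_Algebra.Formal_Power_Series"
begin

text \<open>
  The type \<open>int \<Rightarrow>\<^sub>0 complex\<close> with its convolution product is the ring of Laurent polynomials
  in \<open>x\<close> over the complex numbers: \<open>Poly_Mapping.single i c\<close> is the monomial \<open>c x^i\<close>.
  In the iterated types below the variable of \<open>poly\<close> over the Laurent polynomials is \<open>y\<close>, and
  the variable of \<open>fps\<close> is \<open>t\<close>. In \<open>complex poly poly\<close> the inner variable is \<open>x\<close> and the
  outer one is \<open>y\<close>.
\<close>

type_synonym laurent = "int \<Rightarrow>\<^sub>0 complex"

definition laurent_of_poly :: "complex poly \<Rightarrow> laurent" where
  "laurent_of_poly p = (\<Sum>k\<le>degree p. Poly_Mapping.single (int k) (coeff p k))"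

definition embed_fps :: "complex poly poly fps \<Rightarrow> laurent poly fps" where
  "embed_fps F = Abs_fps (\<lambda>n. map_poly laurent_of_poly (fps_nth F n))"

definition poly_fps_subring :: "laurent poly fps set" where
  "poly_fps_subring = range embed_fps"

text \<open>A commutative ring is a module over itself; its submodules are its ideals.\<close>

definition ideal_generated :: "'a::comm_ring_1 set \<Rightarrow> 'a set" where
  "ideal_generated S = module.span (*) S"

definition f_series :: "(nat \<Rightarrow> complex) \<Rightarrow> laurent poly fps" where
  "f_series a = Abs_fps (\<lambda>n. if n = 0 then [:0, 1:]
                              else [:Poly_Mapping.single (- int n) (a n):])"

lemma module_mult: "module ((*) :: 'a::comm_ring_1 \<Rightarrow> 'a \<Rightarrow> 'a)"
  by unfold_locales (simp_all add: algebra_simps)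

lemma ideal_generated_singleton: "ideal_generated {f} = range (\<lambda>g. g * f)"
  unfolding ideal_generated_def by (rule module.span_singleton[OF module_mult])

lemma lookup_laurent_of_poly:
  "Poly_Mapping.lookup (laurent_of_poly p) i = (if i < 0 then 0 else coeff p (nat i))"
proof -
  have "Poly_Mapping.lookup (laurent_of_poly p) i = (\<Sum>k\<le>degree p. if int k = i then coeff p k else 0)"
    by (simp add: laurent_of_poly_def lookup_sum lookup_single when_def)
  also have "\<dots> = (\<Sum>k\<le>degree p. if k = nat i then (if i < 0 then 0 else coeff p k) else 0)"
    by (rule sum.cong) auto
  also have "\<dots> = (if i < 0 then 0 else coeff p (nat i))"
    by (auto simp: coeff_eq_0)
  finally show ?thesis .
qed

lemma laurent_of_poly_0 [simp]: "laurent_of_poly 0 = 0"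
  by (simp add: laurent_of_poly_def)

lemma laurent_of_poly_1 [simp]: "laurent_of_poly 1 = 1"
  by (simp add: laurent_of_poly_def)

lemma laurent_of_poly_add: "laurent_of_poly (p + q) = laurent_of_poly p + laurent_of_poly q"
  by (rule poly_mapping_eqI) (simp add: lookup_laurent_of_poly lookup_add)

lemma laurent_of_poly_monom: "laurent_of_poly (monom c n) = Poly_Mapping.single (int n) c"
  by (rule poly_mapping_eqI) (auto simp: lookup_laurent_of_poly lookup_single when_def)

lemma laurent_of_poly_sum: "laurent_of_poly (sum g A) = (\<Sum>i\<in>A. laurent_of_poly (g i))"
  by (induction A rule: infinite_finite_induct) (simp_all add: laurent_of_poly_add)

lemma laurent_of_poly_mult: "laurent_of_poly (p * q) = laurent_of_poly p * laurent_of_poly q"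
proof -
  have "p * q = (\<Sum>i\<le>degree p. \<Sum>j\<le>degree q. monom (coeff p i) i * monom (coeff q j) j)"
    by (simp add: sum_product [symmetric] poly_as_sum_of_monoms)
  then show ?thesis
    by (simp add: mult_monom laurent_of_poly_sum laurent_of_poly_monom)
      (simp add: laurent_of_poly_def sum_product mult_single)
qed

lemma inj_laurent_of_poly: "inj laurent_of_poly"
proof (rule injI, rule poly_eqI)
  fix p q n assume "laurent_of_poly p = laurent_of_poly q"
  then have "Poly_Mapping.lookup (laurent_of_poly p) (int n) = Poly_Mapping.lookup (laurent_of_poly q) (int n)" by simp
  then show "coeff p n = coeff q n" by (simp add: lookup_laurent_of_poly)
qed

lemma coeff_embed_fps:
  "coeff (fps_nth (embed_fps F) n) k = laurent_of_poly (coeff (fps_nth F n) k)"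
  by (simp add: embed_fps_def coeff_map_poly)

lemma embed_fps_add: "embed_fps (F + G) = embed_fps F + embed_fps G"
  by (intro fps_ext poly_eqI) (simp add: coeff_embed_fps laurent_of_poly_add)

lemma embed_fps_mult: "embed_fps (F * G) = embed_fps F * embed_fps G"
  by (intro fps_ext poly_eqI)
    (simp add: coeff_embed_fps fps_mult_nth coeff_sum coeff_mult laurent_of_poly_sum
      laurent_of_poly_mult)

lemma embed_fps_1: "embed_fps 1 = 1"
  by (intro fps_ext poly_eqI) (simp add: coeff_embed_fps fps_one_nth coeff_1)

lemma inj_embed_fps: "inj embed_fps"
  by (intro injI fps_ext poly_eqI)
    (metis coeff_embed_fps inj_laurent_of_poly injD)

end

theory Submission
  imports Defs "HOL-Analysis.FPS_Convergence"
begin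

text \<open>
  The series \<open>f\<close> depends on \<open>x\<close> and \<open>t\<close> through \<open>s = t/x\<close> only: it is \<open>y + A(s)\<close> with
  \<open>A(s) = a 1 s + a 2 s^2 + \<dots>\<close>. It is therefore homogeneous of weight 0 if \<open>x\<close> and \<open>t\<close> have
  weight 1 and \<open>y\<close> has weight 0. If \<open>h = g f\<close>, then the part of \<open>h\<close> of weight \<open>N\<close> is
  \<open>x^N H(s, y)\<close>, where \<open>H\<close> is a multiple of \<open>y + A(s)\<close> in \<open>\<complex>[y][[s]]\<close>
  (\<open>weight_part_mult_f_series\<close>).

  Suppose now that \<open>h\<close> involves no negative power of \<open>x\<close>. A monomial \<open>x^i t^n\<close> of weight \<open>N\<close> then
  has \<open>n \<le> N\<close>, so \<open>H\<close> is a polynomial in \<open>s\<close>, and \<open>H(s, -A(s)) = 0\<close>. If \<open>H\<close> were nonzero,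
  \<open>A\<close> would be algebraic over \<open>\<complex>(s)\<close> (\<open>algebraic_of_polynomial_multiple\<close>). But an algebraic
  power series has a positive radius of convergence (\<open>conv_radius_pos_of_algebraic\<close>), whereas
  the growth of the coefficients \<open>a i\<close> gives \<open>A\<close> the radius 0. So all weight parts of \<open>h\<close> vanish.

  The convergence of algebraic series is proved by a Newton step at a simple root, which turns
  the algebraic equation into a fixed-point equation \<open>C = V + X \<cdot> W(C)\<close> with convergent data,
  and a majorant estimate for this equation (\<open>conv_radius_pos_of_fixed_point\<close>).
\<close>

section \<open>Truncated weighted norms of power series\<close>

text \<open>
  The partial sums of the weighted \<open>\<ell>\<^sup>1\<close> norm. They are finite for every series, convergent or
  not, so a bound on them that is uniform in the truncation order can be proved by induction on
  that order.
\<close>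

definition trunc_norm :: "real \<Rightarrow> nat \<Rightarrow> complex fps \<Rightarrow> real" where
  "trunc_norm r N F = (\<Sum>n\<le>N. norm (fps_nth F n) * r ^ n)"

lemma trunc_norm_nonneg: "r \<ge> 0 \<Longrightarrow> trunc_norm r N F \<ge> 0"
  by (simp add: trunc_norm_def sum_nonneg)

lemma trunc_norm_mono: "0 \<le> r \<Longrightarrow> r \<le> s \<Longrightarrow> trunc_norm r N F \<le> trunc_norm s N F"
  unfolding trunc_norm_def by (intro sum_mono mult_left_mono power_mono) auto

lemma trunc_norm_add:
  assumes "r \<ge> 0" shows "trunc_norm r N (F + G) \<le> trunc_norm r N F + trunc_norm r N G"
proof -
  have "trunc_norm r N (F + G) \<le> (\<Sum>n\<le>N. (norm (fps_nth F n) + norm (fps_nth G n)) * r ^ n)"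
    unfolding trunc_norm_def using assms
    by (intro sum_mono mult_right_mono) (auto intro: norm_triangle_ineq)
  then show ?thesis by (simp add: trunc_norm_def algebra_simps sum.distrib)
qed

lemma trunc_norm_mult:
  assumes "r \<ge> 0" shows "trunc_norm r N (F * G) \<le> trunc_norm r N F * trunc_norm r N G"
proof -
  let ?a = "\<lambda>n. norm (fps_nth F n) * r ^ n" and ?b = "\<lambda>n. norm (fps_nth G n) * r ^ n"
  have "trunc_norm r N (F * G) \<le> (\<Sum>n\<le>N. \<Sum>i\<le>n. ?a i * ?b (n - i))"
    unfolding trunc_norm_def
  proof (rule sum_mono)
    fix n assume "n \<in> {..N}"
    have "norm (fps_nth (F * G) n) \<le> (\<Sum>i\<le>n. norm (fps_nth F i) * norm (fps_nth G (n - i)))"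
      by (simp add: fps_mult_nth atLeast0AtMost flip: norm_mult) (rule norm_sum)
    then have "norm (fps_nth (F * G) n) * r ^ n
        \<le> (\<Sum>i\<le>n. norm (fps_nth F i) * norm (fps_nth G (n - i))) * r ^ n"
      using assms by (intro mult_right_mono) auto
    also have "\<dots> = (\<Sum>i\<le>n. ?a i * ?b (n - i))"
      by (simp add: sum_distrib_right) (rule sum.cong, auto simp: power_add[symmetric] mult_ac)
    finally show "norm (fps_nth (F * G) n) * r ^ n \<le> (\<Sum>i\<le>n. ?a i * ?b (n - i))" .
  qed
  also have "\<dots> = (\<Sum>(i, j)\<in>{(i, j). i + j \<le> N}. ?a i * ?b j)"
    by (simp add: sum.triangle_reindex_eq)
  also have "\<dots> \<le> (\<Sum>(i, j)\<in>{..N} \<times> {..N}. ?a i * ?b j)"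
    using assms by (intro sum_mono2) auto
  also have "\<dots> = trunc_norm r N F * trunc_norm r N G"
    by (simp add: trunc_norm_def sum_product sum.cartesian_product)
  finally show ?thesis .
qed

text \<open>
  Multiplication by the variable raises the truncation order by one. This is what makes the
  fixed-point estimate below an induction on the order.
\<close>

lemma trunc_norm_X_mult:
  "trunc_norm r (Suc N) (fps_X * F) = r * trunc_norm r N F"
  unfolding trunc_norm_def by (simp add: sum.atMost_Suc_shift sum_distrib_left mult_ac del: sum.atMost_Suc)

lemma trunc_norm_poly:
  assumes "r \<ge> 0" and "\<And>i. trunc_norm r N (coeff W i) \<le> K i" and "trunc_norm r N F \<le> x"
  shows "trunc_norm r N (poly W F) \<le> (\<Sum>i\<le>degree W. K i * x ^ i)"
proof -
  have x0: "x \<ge> 0" using assms trunc_norm_nonneg order_trans by blast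
  have pw: "trunc_norm r N (G * F ^ i) \<le> trunc_norm r N G * x ^ i" for G i
  proof (induction i)
    case (Suc i)
    have "trunc_norm r N (G * F ^ Suc i) \<le> trunc_norm r N (G * F ^ i) * trunc_norm r N F"
      using trunc_norm_mult[OF assms(1), of N "G * F ^ i" F] by (simp add: mult_ac)
    also have "\<dots> \<le> (trunc_norm r N G * x ^ i) * x"
      using Suc assms x0 by (intro mult_mono) (auto simp: trunc_norm_nonneg)
    finally show ?case by (simp add: mult_ac)
  qed simp
  have "trunc_norm r N (\<Sum>i\<in>I. coeff W i * F ^ i) \<le> (\<Sum>i\<in>I. K i * x ^ i)" if "finite I" for I
    using that
  proof (induction I rule: finite_induct)
    case empty
    then show ?case by (simp add: trunc_norm_def)
  next
    case (insert j I)
    have "trunc_norm r N (coeff W j * F ^ j) \<le> K j * x ^ j"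
      using pw[of "coeff W j" j] assms(2)[of j] x0
      by (meson mult_right_mono order_trans zero_le_power)
    then show ?case
      using insert trunc_norm_add[OF assms(1), of N "coeff W j * F ^ j" "\<Sum>i\<in>I. coeff W i * F ^ i"]
      by simp
  qed
  then show ?thesis by (simp add: poly_altdef)
qed

lemma conv_radius_pos_iff_trunc_norm_bounded:
  "fps_conv_radius F > 0 \<longleftrightarrow> (\<exists>r>0. \<exists>K. \<forall>N. trunc_norm r N F \<le> K)"
proof
  assume "fps_conv_radius F > 0"
  then obtain r where r: "r > 0" "ereal r < fps_conv_radius F"
    by (metis ereal_dense2 ereal_less(2))
  have s: "summable (\<lambda>n. norm (fps_nth F n) * r ^ n)"
    using abs_summable_in_conv_radius[of "of_real r" "fps_nth F"] r
    by (simp add: fps_conv_radius_def norm_mult norm_power)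
  have "trunc_norm r N F \<le> suminf (\<lambda>n. norm (fps_nth F n) * r ^ n)" for N
    unfolding trunc_norm_def using s r by (intro sum_le_suminf) auto
  with r show "\<exists>r>0. \<exists>K. \<forall>N. trunc_norm r N F \<le> K" by blast
next
  assume "\<exists>r>0. \<exists>K. \<forall>N. trunc_norm r N F \<le> K"
  then obtain r K where r: "r > 0" and K: "\<And>N. trunc_norm r N F \<le> K" by blast
  have "summable (\<lambda>n. norm (fps_nth F n) * r ^ n)"
  proof (rule summableI_nonneg_bounded)
    show "(\<Sum>i<n. norm (fps_nth F i) * r ^ i) \<le> K" for n
    proof -
      have "(\<Sum>i<n. norm (fps_nth F i) * r ^ i) \<le> trunc_norm r n F"
        unfolding trunc_norm_def using r by (intro sum_mono2) auto
      then show ?thesis using K[of n] by simp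
    qed
  qed (use r in auto)
  then have "summable (\<lambda>n. fps_nth F n * of_real r ^ n)"
    using r by (intro summable_norm_cancel[of "\<lambda>n. fps_nth F n * of_real r ^ n"])
      (simp add: norm_mult norm_power)
  then have "ereal r \<le> fps_conv_radius F"
    using conv_radius_geI[of "fps_nth F" "of_real r"] r by (simp add: fps_conv_radius_def)
  with r show "fps_conv_radius F > 0"
    by (auto intro: less_le_trans[of 0 "ereal r"])
qed

text \<open>
  If \<open>V\<close> and the coefficients of \<open>W\<close> have norm at most some constants, then the norm of \<open>C\<close>
  truncated at order \<open>N + 1\<close> is at most \<open>K + r \<Phi>\<close>, provided that at order \<open>N\<close> it is at most
  \<open>2 K\<close>; here \<open>\<Phi>\<close> bounds the norm of \<open>W(C)\<close>. Shrinking \<open>r\<close> does not increase the bounds for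
  \<open>V\<close> and \<open>W\<close>, and once \<open>r \<Phi> \<le> K\<close> the bound \<open>2 K\<close> propagates to all orders.
\<close>

lemma conv_radius_pos_of_fixed_point:
  fixes C :: "complex fps"
  assumes V: "fps_conv_radius V > 0" and W: "\<And>i. fps_conv_radius (coeff W i) > 0"
    and C: "C = V + fps_X * poly W C"
  shows "fps_conv_radius C > 0"
proof -
  define FS where "FS = insert V (coeff W ` {..degree W})"
  have "\<forall>F\<in>FS. \<exists>r>0. \<exists>K. \<forall>N. trunc_norm r N F \<le> K"
    using V W by (auto simp: FS_def conv_radius_pos_iff_trunc_norm_bounded)
  then obtain \<rho> \<kappa> where rk: "\<And>F. F \<in> FS \<Longrightarrow> \<rho> F > (0::real)"
      "\<And>F N. F \<in> FS \<Longrightarrow> trunc_norm (\<rho> F) N F \<le> \<kappa> F"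
    by metis
  have fin: "finite FS" "FS \<noteq> {}" by (auto simp: FS_def)
  define R where "R = Min (\<rho> ` FS)"
  have R: "R > 0" "\<And>F. F \<in> FS \<Longrightarrow> R \<le> \<rho> F"
    unfolding R_def using fin rk by auto
  define K where "K = max 1 (\<kappa> V)"
  define \<Phi> where "\<Phi> = (\<Sum>i\<le>degree W. (if i \<le> degree W then \<kappa> (coeff W i) else 0) * (2 * K) ^ i)"
  define r where "r = min R (K / (\<bar>\<Phi>\<bar> + 1))"
  have K: "K \<ge> 1" "K \<ge> \<kappa> V" by (auto simp: K_def)
  have r: "r > 0" "r \<le> R" using R K by (auto simp: r_def)
  have "r * \<Phi> \<le> r * (\<bar>\<Phi>\<bar> + 1)" using r by (intro mult_left_mono) auto
  also have "\<dots> \<le> K" using K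
    by (simp add: r_def min_mult_distrib_right)
  finally have r\<Phi>: "r * \<Phi> \<le> K" .
  have bd: "trunc_norm r N F \<le> \<kappa> F" if "F \<in> FS" for N F
    using trunc_norm_mono[of r "\<rho> F" N F] rk(2)[OF that, of N] R(2)[OF that] r by linarith
  \<comment> \<open>\<open>\<kappa>\<close> is meaningful up to the degree only, and the coefficients beyond it vanish\<close>
  have bW: "trunc_norm r N (coeff W i) \<le> (if i \<le> degree W then \<kappa> (coeff W i) else 0)" for N i
    using bd[of "coeff W i" N] by (auto simp: FS_def coeff_eq_0 trunc_norm_def)
  have bV: "trunc_norm r N V \<le> K" for N
    using bd[of V N] K by (auto simp: FS_def)
  have "trunc_norm r N C \<le> 2 * K" for N
  proof (induction N)
    case 0
    have "trunc_norm r 0 C = trunc_norm r 0 V"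
      by (subst C) (simp add: trunc_norm_def)
    then show ?case using bV[of 0] K by simp
  next
    case (Suc N)
    have "trunc_norm r (Suc N) C \<le> trunc_norm r (Suc N) V + r * trunc_norm r N (poly W C)"
      by (subst C) (metis trunc_norm_add trunc_norm_X_mult less_imp_le r(1))
    also have "r * trunc_norm r N (poly W C) \<le> r * \<Phi>"
      unfolding \<Phi>_def using r bW Suc by (intro mult_left_mono trunc_norm_poly) auto
    finally show ?case using bV[of "Suc N"] r\<Phi> by simp
  qed
  with r show ?thesis unfolding conv_radius_pos_iff_trunc_norm_bounded by blast
qed

section \<open>Power series that are algebraic over convergent ones converge\<close>

lemma conv_radius_pos_add: "fps_conv_radius F > 0 \<Longrightarrow> fps_conv_radius G > 0
    \<Longrightarrow> fps_conv_radius (F + G) > 0"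
  for F G :: "complex fps"
  using fps_conv_radius_add[of F G] by (simp add: less_le_trans min_def split: if_splits)

lemma conv_radius_pos_mult: "fps_conv_radius F > 0 \<Longrightarrow> fps_conv_radius G > 0
    \<Longrightarrow> fps_conv_radius (F * G) > 0"
  for F G :: "complex fps"
  using fps_conv_radius_mult[of F G] by (simp add: less_le_trans min_def split: if_splits)

lemma conv_radius_pos_sum: "(\<And>i. i \<in> I \<Longrightarrow> fps_conv_radius (F i) > 0)
    \<Longrightarrow> fps_conv_radius (\<Sum>i\<in>I. F i) > 0"
  for F :: "'i \<Rightarrow> complex fps"
  by (induction I rule: infinite_finite_induct) (auto intro: conv_radius_pos_add)

definition conv_poly :: "complex fps poly \<Rightarrow> bool" where
  "conv_poly P \<longleftrightarrow> (\<forall>i. fps_conv_radius (coeff P i) > 0)"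

lemma conv_poly_pCons: "conv_poly (pCons F P) \<longleftrightarrow> fps_conv_radius F > 0 \<and> conv_poly P"
  by (auto simp: conv_poly_def coeff_pCons split: nat.splits)

lemma conv_poly_0 [simp]: "conv_poly 0"
  by (simp add: conv_poly_def)

lemma conv_poly_add: "conv_poly P \<Longrightarrow> conv_poly Q \<Longrightarrow> conv_poly (P + Q)"
  by (simp add: conv_poly_def conv_radius_pos_add)

lemma conv_poly_mult: "conv_poly P \<Longrightarrow> conv_poly Q \<Longrightarrow> conv_poly (P * Q)"
  by (simp add: conv_poly_def coeff_mult conv_radius_pos_sum conv_radius_pos_mult)

lemma conv_poly_smult: "fps_conv_radius F > 0 \<Longrightarrow> conv_poly P \<Longrightarrow> conv_poly (smult F P)"
  by (simp add: conv_poly_def conv_radius_pos_mult)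

lemma conv_poly_pcompose: "conv_poly P \<Longrightarrow> conv_poly Q \<Longrightarrow> conv_poly (pcompose P Q)"
  by (induction P) (auto simp: pcompose_pCons conv_poly_pCons intro!: conv_poly_add conv_poly_mult)

lemma conv_poly_pderiv: "conv_poly P \<Longrightarrow> conv_poly (pderiv P)"
  by (induction P) (auto simp: pderiv_pCons conv_poly_pCons intro!: conv_poly_add)

text \<open>
  Newton's method. Let \<open>m\<close> be the order of vanishing of \<open>P'(A)\<close>, and split off from \<open>A\<close> its
  truncation \<open>B\<close> at order \<open>k = m + 1\<close>, so that \<open>A = B + X^k C\<close>. In the Taylor expansion
  \<open>P(B + D) = T0 + T1 D + S(D) D^2\<close> the coefficient \<open>T1 = P'(B)\<close> agrees with \<open>P'(A)\<close> up to order
  \<open>m\<close>, so it is \<open>X^m\<close> times a unit \<open>U\<close>. Putting \<open>D = X^k C\<close>, the linear term is divisible by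
  \<open>X^(k + m)\<close> and the quadratic one by \<open>X^(2 k) = X^(k + m + 1)\<close>. After division by \<open>X^(k + m)\<close>
  the equation can be solved for \<open>C\<close> modulo terms divisible by \<open>X\<close>, which puts it into the form
  of the fixed-point lemma.
\<close>

lemma conv_radius_pos_of_simple_root:
  assumes P: "conv_poly P" and root: "poly P A = 0" and simple: "poly (pderiv P) A \<noteq> 0"
  shows "fps_conv_radius A > 0"
proof -
  define m where "m = subdegree (poly (pderiv P) A)"
  define k where "k = Suc m"
  define B where "B = fps_cutoff k A"
  define C where "C = fps_shift k A"
  have A: "A = B + fps_X ^ k * C"
    unfolding B_def C_def by (rule fps_ext) (simp add: fps_X_power_mult_nth)
  have "eventually (\<lambda>n. fps_nth B n = (\<lambda>_. 0) n) sequentially"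
    unfolding B_def eventually_sequentially by (intro exI[of _ k]) simp
  then have "conv_radius (fps_nth B) = conv_radius (\<lambda>_. 0 :: complex)"
    by (rule conv_radius_cong')
  then have B: "fps_conv_radius B > 0"
    by (simp add: fps_conv_radius_def)
  obtain T0 T1 S where T: "pcompose P [:B, 1:] = pCons T0 (pCons T1 S)"
    by (metis pCons_cases)
  have "conv_poly (pcompose P [:B, 1:])"
    using P B by (intro conv_poly_pcompose) (auto simp: conv_poly_pCons)
  then have conv: "fps_conv_radius T0 > 0" "fps_conv_radius T1 > 0" "conv_poly S"
    by (simp_all add: T conv_poly_pCons)
  \<comment> \<open>\<open>T1\<close> is \<open>P'(B)\<close>, which is compared with \<open>P'(A)\<close> through the expansion of \<open>P'\<close> at \<open>B\<close>\<close>
  obtain T' R where T': "pcompose (pderiv P) [:B, 1:] = pCons T' R"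
    by (metis pCons_cases)
  have "pderiv (pcompose P [:B, 1:]) = pcompose (pderiv P) [:B, 1:]"
    by (simp add: pderiv_pcompose pderiv_pCons)
  then have "T' = T1"
    unfolding T T' by (simp add: pderiv_pCons)
  then have "poly (pderiv P) A = T1 + fps_X ^ k * C * poly R (fps_X ^ k * C)"
    using arg_cong[OF T', of "\<lambda>Q. poly Q (fps_X ^ k * C)"] by (simp add: poly_pcompose A)
  \<comment> \<open>the correction term is divisible by \<open>X^k\<close>, and \<open>m < k\<close>\<close>
  then have T1_nth: "fps_nth T1 n = fps_nth (poly (pderiv P) A) n" if "n \<le> m" for n
    using that by (simp add: k_def mult.assoc fps_X_power_mult_nth del: power_Suc)
  define U where "U = fps_shift m T1"
  have T1: "T1 = fps_X ^ m * U"
    unfolding U_def by (rule fps_ext) (auto simp: fps_X_power_mult_nth T1_nth m_def)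
  define u where "u = fps_nth U 0"
  have u: "u \<noteq> 0" unfolding u_def U_def using simple by (simp add: T1_nth) (simp add: m_def)
  define U' where "U' = fps_shift 1 U"
  have U: "U = fps_const u + fps_X * U'"
    unfolding U'_def u_def by (rule fps_ext) (auto simp: fps_X_mult_nth)
  define S' where "S' = pcompose S [:0, fps_X ^ k:]"
  have S': "poly S (fps_X ^ k * C) = poly S' C"
    by (simp add: S'_def poly_pcompose mult.commute)
  have "poly (pcompose P [:B, 1:]) (fps_X ^ k * C) = 0"
    using root by (simp add: poly_pcompose A)
  then have "T0 + fps_X ^ k * C * (T1 + fps_X ^ k * C * poly S' C) = 0"
    by (simp add: T S')
  then have T0: "T0 = fps_X ^ (k + m) * (- (C * (U + fps_X * C * poly S' C)))"
    by (simp add: T1 k_def power_add algebra_simps eq_neg_iff_add_eq_0)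
  define V where "V = fps_shift (k + m) T0"
  have "V = - (C * (U + fps_X * C * poly S' C))"
    unfolding V_def T0 by (subst mult.commute) (rule fps_shift_times_fps_X_power')
  then have CU: "fps_const u * C = - V - fps_X * (U' * C + C * C * poly S' C)"
    by (subst (asm) U) (simp add: algebra_simps eq_neg_iff_add_eq_0)
  define c where "c = fps_const (- inverse u)"
  define W where "W = smult c ([:0, U':] + [:0, 0, 1:] * S')"
  have "C = fps_const (inverse u) * (fps_const u * C)"
    using u by (simp flip: mult.assoc)
  also have "\<dots> = c * V + fps_X * poly W C"
    unfolding CU by (simp add: c_def W_def algebra_simps fps_const_neg[symmetric] del: fps_const_neg)
  finally have C: "C = c * V + fps_X * poly W C" .
  have "fps_conv_radius C > 0"
  proof (rule conv_radius_pos_of_fixed_point[OF _ _ C])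
    show "fps_conv_radius (c * V) > 0"
      using conv by (intro conv_radius_pos_mult) (auto simp: c_def V_def)
    have "conv_poly W"
      unfolding W_def S'_def using conv
      by (intro conv_poly_smult conv_poly_add conv_poly_mult conv_poly_pcompose)
         (auto simp: conv_poly_pCons c_def U'_def U_def)
    then show "fps_conv_radius (coeff W i) > 0" for i by (simp add: conv_poly_def)
  qed
  then show ?thesis unfolding C_def by simp
qed

text \<open>
  A multiple root of \<open>P\<close> is a root of its derivative, which is again a nonzero polynomial with
  convergent coefficients. Descending along the derivatives thus ends at a simple root.
\<close>

theorem conv_radius_pos_of_algebraic:
  assumes "conv_poly P" "P \<noteq> 0" "poly P A = 0"
  shows "fps_conv_radius A > 0"
  using assms
proof (induction "degree P" arbitrary: P rule: less_induct)
  case less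
  have deg: "degree P > 0"
  proof (rule ccontr)
    assume "\<not> degree P > 0"
    then obtain c where "P = [:c:]" by (metis degree_eq_zeroE neq0_conv)
    with less show False by simp
  qed
  show ?case
  proof (cases "poly (pderiv P) A = 0")
    case True
    show ?thesis
      by (rule less.hyps[OF _ conv_poly_pderiv[OF less.prems(1)] _ True])
        (use deg in \<open>auto simp: degree_pderiv pderiv_eq_0_iff\<close>)
  next
    case False
    then show ?thesis using conv_radius_pos_of_simple_root less.prems by blast
  qed
qed

section \<open>Decomposition by weight\<close>

text \<open>
  Give \<open>x\<close> and \<open>t\<close> the weight 1 and \<open>y\<close> the weight 0. Every monomial of weight \<open>N\<close> has the form
  \<open>x^(N - n) y^k t^n = x^N y^k s^n\<close> with \<open>s = t/x\<close>, so the part of weight \<open>N\<close> of a series in \<open>t\<close>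
  is recorded, without the factor \<open>x^N\<close>, as a series in \<open>s\<close> with coefficients in
  \<open>\<complex>[y]\<close>.
\<close>

definition weight_part :: "int \<Rightarrow> laurent poly fps \<Rightarrow> complex poly fps" where
  "weight_part N G = Abs_fps (\<lambda>n. map_poly (\<lambda>c. Poly_Mapping.lookup c (N - int n)) (fps_nth G n))"

lemma coeff_weight_part:
  "coeff (fps_nth (weight_part N G) n) k = Poly_Mapping.lookup (coeff (fps_nth G n) k) (N - int n)"
  by (simp add: weight_part_def coeff_map_poly)

lemma weight_part_eq_0_imp:
  assumes "\<And>N. weight_part N G = 0"
  shows "G = 0"
proof (intro fps_ext poly_eqI poly_mapping_eqI)
  fix n k i
  show "Poly_Mapping.lookup (coeff (fps_nth G n) k) i
      = Poly_Mapping.lookup (coeff (fps_nth 0 n) k) i"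
    using coeff_weight_part[of "i + int n" G n k] by (simp add: assms)
qed

lemma lookup_mult_single:
  "Poly_Mapping.lookup (q * Poly_Mapping.single j c) i = Poly_Mapping.lookup q (i - j) * c"
  for q :: laurent
proof -
  have "Sum_any (\<lambda>m. Poly_Mapping.lookup (Poly_Mapping.single j c) m when i = l + m)
      = (c when l = i - j)" for l
  proof -
    have "(\<lambda>m. Poly_Mapping.lookup (Poly_Mapping.single j c) m when i = l + m)
        = (\<lambda>m. (c when l = i - j) when m = i - l)"
      by (auto simp: fun_eq_iff lookup_single when_def)
    then show ?thesis by (simp only: Sum_any_when_equal)
  qed
  then have "Poly_Mapping.lookup (q * Poly_Mapping.single j c) i
      = Sum_any (\<lambda>l. Poly_Mapping.lookup q l * c when l = i - j)"
    by (simp add: lookup_mult mult_when)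
  then show ?thesis by simp
qed

text \<open>
  This is \<open>f\<close> written in terms of \<open>s = t/x\<close>.
\<close>

definition y_plus :: "(nat \<Rightarrow> complex) \<Rightarrow> complex poly fps" where
  "y_plus a = Abs_fps (\<lambda>n. if n = 0 then [:0, 1:] else [:a n:])"

text \<open>
  Every term of \<open>f\<close> has weight 0, so multiplication by \<open>f\<close> respects the weight decomposition.
\<close>

lemma weight_part_mult_f_series:
  "weight_part N (G * f_series a) = weight_part N G * y_plus a"
proof (intro fps_ext poly_eqI)
  fix n k
  have "Poly_Mapping.lookup (coeff (fps_nth G i * fps_nth (f_series a) (n - i)) k) (N - int n)
      = coeff (fps_nth (weight_part N G) i * fps_nth (y_plus a) (n - i)) k" if "i \<le> n" for i
    using that
    by (auto simp: f_series_def y_plus_def coeff_pCons coeff_weight_part lookup_mult_single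
        of_nat_diff algebra_simps split: nat.splits)
  then show "coeff (fps_nth (weight_part N (G * f_series a)) n) k
      = coeff (fps_nth (weight_part N G * y_plus a) n) k"
    by (simp add: coeff_weight_part fps_mult_nth coeff_sum lookup_sum)
qed

section \<open>Substituting the root for \<open>y\<close>\<close>

definition subst_y :: "complex fps \<Rightarrow> complex poly \<Rightarrow> complex fps" where
  "subst_y B p = poly (map_poly fps_const p) B"

lemma subst_y_add: "subst_y B (p + q) = subst_y B p + subst_y B q"
proof -
  have "map_poly fps_const (p + q) = map_poly fps_const p + map_poly fps_const q"
    by (rule poly_eqI) (simp add: coeff_map_poly)
  then show ?thesis by (simp add: subst_y_def)
qed

lemma subst_y_sum: "subst_y B (\<Sum>i\<in>I. p i) = (\<Sum>i\<in>I. subst_y B (p i))"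
proof (induction I rule: infinite_finite_induct)
qed (simp_all add: subst_y_add, simp_all add: subst_y_def)

lemma subst_y_mult_y: "subst_y B (p * [:0, 1:]) = subst_y B p * B"
  by (simp add: subst_y_def map_poly_pCons mult.commute)

lemma subst_y_mult_const: "subst_y B (p * [:c:]) = subst_y B p * fps_const c"
proof -
  have "map_poly fps_const (smult c p) = smult (fps_const c) (map_poly fps_const p)"
    by (rule poly_eqI) (simp add: coeff_map_poly)
  then show ?thesis by (simp add: subst_y_def mult.commute)
qed

text \<open>
  The constant term is 0 and not \<open>a 0\<close>, so that the root of \<open>f\<close> as a polynomial in \<open>y\<close> is
  the negative of this series.
\<close>

definition seq_series :: "(nat \<Rightarrow> complex) \<Rightarrow> complex fps" where
  "seq_series a = Abs_fps (\<lambda>n. if n = 0 then 0 else a n)"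

text \<open>
  Write \<open>A = a 1 s + a 2 s^2 + \<dots>\<close>. The left-hand side is the coefficient of \<open>s^m\<close> in
  \<open>(G \<cdot> (y + A))(s, -A)\<close>, where the substitution is legitimate for arbitrary \<open>G\<close> in
  \<open>\<complex>[y][[s]]\<close>, as the term of index \<open>n\<close> contributes from order \<open>n\<close> on only. The factor
  \<open>y + A\<close> becomes 0: the two double sums that come from \<open>y\<close> and from \<open>A\<close> have the same terms.
\<close>

lemma subst_root_y_plus_multiple:
  "(\<Sum>n\<le>m. fps_nth (subst_y (- seq_series a) (fps_nth (G * y_plus a) n)) (m - n)) = 0"
proof -
  let ?A = "seq_series a"
  define e where "e n j = fps_nth (subst_y (- ?A) (fps_nth G n)) j" for n j
  define b where "b n = fps_nth ?A n" for n
  have H: "subst_y (- ?A) (fps_nth (G * y_plus a) n)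
      = - (subst_y (- ?A) (fps_nth G n) * ?A)
        + (\<Sum>i\<le>n. subst_y (- ?A) (fps_nth G i) * fps_const (b (n - i)))"
    for n
  proof -
    have "fps_nth (G * y_plus a) n = (\<Sum>i\<le>n. fps_nth G i * fps_nth (y_plus a) (n - i))"
      by (simp add: fps_mult_nth atLeast0AtMost)
    \<comment> \<open>\<open>b 0 = 0\<close>, so the constant term \<open>y\<close> can be split off from the terms with \<open>b\<close>\<close>
    also have "\<dots> = (\<Sum>i\<le>n. (if i = n then fps_nth G i * [:0, 1:] else 0) + fps_nth G i * [:b (n - i):])"
      by (rule sum.cong) (auto simp: y_plus_def b_def seq_series_def)
    also have "\<dots> = fps_nth G n * [:0, 1:] + (\<Sum>i\<le>n. fps_nth G i * [:b (n - i):])"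
      by (simp add: sum.distrib)
    finally show ?thesis
      by (simp only: subst_y_add subst_y_sum subst_y_mult_y subst_y_mult_const) simp
  qed
  have "(\<Sum>n\<le>m. fps_nth (subst_y (- ?A) (fps_nth (G * y_plus a) n)) (m - n))
      = - (\<Sum>n\<le>m. \<Sum>j\<le>m - n. e n j * b (m - n - j)) + (\<Sum>n\<le>m. \<Sum>i\<le>n. e i (m - n) * b (n - i))"
    unfolding H
    by (simp add: sum.distrib sum_negf sum_subtractf fps_mult_nth[of _ ?A] e_def b_def fps_sum_nth atLeast0AtMost)
  also have "(\<Sum>n\<le>m. \<Sum>j\<le>m - n. e n j * b (m - n - j)) = (\<Sum>n\<le>m. \<Sum>i\<le>n. e i (m - n) * b (n - i))"
    unfolding sum.Sigma[OF finite_atMost ballI[OF finite_atMost]]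
    by (rule sum.reindex_bij_witness[of _ "\<lambda>(n, i). (i, m - n)" "\<lambda>(n, j). (m - j, n)"])
       (auto simp: add.commute)
  finally show ?thesis by simp
qed

text \<open>
  A multiple of \<open>y + A\<close> in \<open>\<complex>[y][[s]]\<close> that happens to be a polynomial in \<open>s\<close> as well can be
  regarded as a polynomial in \<open>y\<close> over \<open>\<complex>[s]\<close>, and as such it has the root \<open>-A\<close>.
\<close>

lemma algebraic_of_polynomial_multiple:
  assumes bound: "\<And>n. n > M \<Longrightarrow> fps_nth (G * y_plus a) n = 0" and nonzero: "G * y_plus a \<noteq> 0"
  shows "\<exists>P. conv_poly P \<and> P \<noteq> 0 \<and> poly P (- seq_series a) = 0"
proof -
  define H where "H = G * y_plus a"
  define P where "P = (\<Sum>n\<le>M. smult (fps_X ^ n) (map_poly fps_const (fps_nth H n)))"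
  have coeff_P: "coeff P k = (\<Sum>n\<le>M. fps_X ^ n * fps_const (coeff (fps_nth H n) k))" for k
    by (simp add: P_def coeff_sum coeff_map_poly)
  have "conv_poly P"
    unfolding conv_poly_def coeff_P
    by (intro allI conv_radius_pos_sum conv_radius_pos_mult) simp_all
  moreover have "P \<noteq> 0"
  proof
    assume "P = 0"
    have "coeff (fps_nth H n) k = 0" for n k
    proof (cases "n \<le> M")
      case True
      have "fps_nth (coeff P k) n = (\<Sum>i\<le>M. if i = n then coeff (fps_nth H i) k else 0)"
        unfolding coeff_P fps_sum_nth
        by (rule sum.cong) (auto simp: fps_X_power_mult_nth)
      with True \<open>P = 0\<close> show ?thesis by simp
    qed (use bound in \<open>simp add: H_def\<close>)
    then have "H = 0" by (intro fps_ext poly_eqI) simp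
    with nonzero show False by (simp add: H_def)
  qed
  moreover have "poly P (- seq_series a) = 0"
  proof (rule fps_ext)
    fix m
    let ?c = "\<lambda>n. fps_nth (subst_y (- seq_series a) (fps_nth H n)) (m - n)"
    have "fps_nth (poly P (- seq_series a)) m = (\<Sum>n\<le>M. if n \<le> m then ?c n else 0)"
      by (simp add: P_def poly_sum fps_sum_nth fps_X_power_mult_nth subst_y_def not_le)
         (rule sum.cong, auto simp: subst_y_def)
    also have "\<dots> = (\<Sum>n\<le>m. ?c n)"
      by (rule sum.mono_neutral_cong) (auto simp: H_def bound subst_y_def)
    also have "\<dots> = 0"
      unfolding H_def by (rule subst_root_y_plus_multiple)
    finally show "fps_nth (poly P (- seq_series a)) m = fps_nth 0 m" by simp
  qed
  ultimately show ?thesis by blast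
qed

section \<open>The ideal contains no nonzero series without negative powers of \<open>x\<close>\<close>

lemma conv_radius_seq_series:
  assumes nonzero: "\<And>i. i \<ge> 1 \<Longrightarrow> a i \<noteq> 0"
    and ratio: "filterlim (\<lambda>i. norm (a (Suc i)) / norm (a i)) at_top sequentially"
  shows "fps_conv_radius (seq_series a) = 0"
proof -
  have "(\<lambda>i. norm (a i) / norm (a (Suc i))) \<longlonglongrightarrow> 0"
    using tendsto_inverse_0_at_top[OF ratio] by simp
  moreover have "eventually (\<lambda>i. a i \<noteq> 0) sequentially"
    using nonzero by (auto simp: eventually_sequentially)
  ultimately have "conv_radius a = 0"
    by (intro conv_radius_ratio_limit[of 0 0]) (simp_all add: zero_ereal_def)
  moreover have "conv_radius (fps_nth (seq_series a)) = conv_radius a"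
    by (rule conv_radius_cong', unfold eventually_sequentially, intro exI[of _ 1])
      (simp add: seq_series_def)
  ultimately show ?thesis by (simp add: fps_conv_radius_def)
qed

text \<open>
  Without negative powers of \<open>x\<close>, a monomial of weight \<open>N\<close> has degree at most \<open>N\<close> in \<open>t\<close>.
\<close>

lemma weight_part_embed_fps:
  assumes "int n > N" shows "fps_nth (weight_part N (embed_fps F)) n = 0"
  using assms by (intro poly_eqI) (simp add: coeff_weight_part coeff_embed_fps lookup_laurent_of_poly)

theorem theorem2p7:
  fixes a :: "nat \<Rightarrow> complex"
  assumes nonzero: "\<And>i. i \<ge> 1 \<Longrightarrow> a i \<noteq> 0"
    and increasing: "strict_mono_on {1..} (\<lambda>i. norm (a i))"
    and ratio: "filterlim (\<lambda>i. norm (a (Suc i)) / norm (a i)) at_top sequentially"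
  shows "ideal_generated {f_series a} \<inter> poly_fps_subring = {0}"
proof
  show "ideal_generated {f_series a} \<inter> poly_fps_subring \<subseteq> {0}"
  proof
    fix h assume "h \<in> ideal_generated {f_series a} \<inter> poly_fps_subring"
    then obtain G F where G: "h = G * f_series a" and F: "h = embed_fps F"
      unfolding ideal_generated_singleton poly_fps_subring_def by blast
    have "weight_part N h = 0" for N
    proof (rule ccontr)
      assume nz: "weight_part N h \<noteq> 0"
      have bound: "fps_nth (weight_part N h) n = 0" if "n > nat N" for n
        unfolding F using that by (intro weight_part_embed_fps) linarith
      have "weight_part N h = weight_part N G * y_plus a"
        unfolding G by (rule weight_part_mult_f_series)
      with nz bound obtain P where "conv_poly P" "P \<noteq> 0" "poly P (- seq_series a) = 0"
        using algebraic_of_polynomial_multiple[of "nat N" "weight_part N G" a] by auto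
      then have "fps_conv_radius (- seq_series a) > 0"
        by (rule conv_radius_pos_of_algebraic)
      then show False
        using conv_radius_seq_series[OF nonzero ratio] by simp
    qed
    then have "h = 0" by (rule weight_part_eq_0_imp)
    then show "h \<in> {0}" by simp
  qed
  have "0 = embed_fps 0"
    by (intro fps_ext poly_eqI) (simp add: coeff_embed_fps)
  then have "0 \<in> poly_fps_subring" by (simp add: poly_fps_subring_def)
  moreover have "0 \<in> ideal_generated {f_series a}"
    by (auto simp: ideal_generated_singleton intro: range_eqI[of _ _ 0])
  ultimately show "{0} \<subseteq> ideal_generated {f_series a} \<inter> poly_fps_subring" by simp
qed

end
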